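(* Let $p \ge 2$ be an integer, let $n \ge 0$ be an integer, and let $C = 2^{p}n + 2^{p-1} - 1$ (an odd natural number). Set $C_{0}=C$, and let $C_{1}, C_{2}$ be the next two terms of the Collatz sequence started at $C_0$. Then $C_{1} = 3C_0+1$ is even, $C_2 = C_1/2$, and $$C_{2} = 2^{p-1}(3n+1) + 2^{p-2} - 1 .$$ That is, applying one odd step followed by one even step to an odd number of standard form with exponent $p$ and index $n$ gives the number of standard form with exponent $p-1$ and index $3n+1$.
   Context: The Collatz sequence of a natural number $C_0\ge 1$ is defined by $C_{i+1} = 3C_i+1$ if $C_i$ is odd (an odd step) and $C_{i+1} = C_i/2$ if $C_i$ is even (an even step). A number is written in standard form with exponent $p\ge 1$ and index $n\ge 0$ (both integers) if it equals $2^{p}n+2^{p-1}-1$. *)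

theory Defs
  imports Main
begin

definition collatz_step :: "nat \<Rightarrow> nat" where
  "collatz_step c = (if odd c then 3 * c + 1 else c div 2)"

primrec collatz :: "nat \<Rightarrow> nat \<Rightarrow> nat" where
  "collatz c 0 = c"
| "collatz c (Suc i) = collatz_step (collatz c i)"

(* The natural-number subtractions never truncate: p \<ge> 1 is required, and 2 ^ (p - 1) \<ge> 1. *)
definition has_standard_form :: "nat \<Rightarrow> nat \<Rightarrow> nat \<Rightarrow> bool" where
  "has_standard_form c p n \<longleftrightarrow> p \<ge> 1 \<and> c = 2 ^ p * n + 2 ^ (p - 1) - 1"

end

theory Submission
  imports Defs
begin

text \<open>Put \<open>m = 2 ^ (p - 1) * n + 2 ^ (p - 2)\<close>, so that
  \<open>C = 2 * m - 1\<close> is odd. The odd step gives \<open>6 * m - 2\<close>, which is even,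
  and halving gives \<open>3 * m - 1\<close>. Since
  \<open>2 ^ (p - 1) + 2 ^ (p - 2) = 3 * 2 ^ (p - 2)\<close>, the number \<open>3 * m - 1\<close> is
  again of standard form.\<close>

theorem mainTheorem1:
  fixes p n C :: nat
  assumes "p \<ge> 2"
    and "C = 2 ^ p * n + 2 ^ (p - 1) - 1"
  shows "odd C
    \<and> collatz C 1 = 3 * C + 1
    \<and> even (collatz C 1)
    \<and> collatz C 2 = collatz C 1 div 2
    \<and> collatz C 2 = 2 ^ (p - 1) * (3 * n + 1) + 2 ^ (p - 2) - 1
    \<and> has_standard_form C p n
    \<and> has_standard_form (collatz C 2) (p - 1) (3 * n + 1)"
proof -
  obtain k where p: "p = k + 2"
    using \<open>p \<ge> 2\<close> by (metis add.commute le_iff_add)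
  \<comment> \<open>The left-hand side is \<open>m\<close>, positive because \<open>2 ^ k\<close>
    is; with \<open>t = m - 1\<close> the Collatz terms are linear in \<open>t\<close> and free of
    truncated subtraction.\<close>
  obtain t where t: "2 ^ (k + 1) * n + 2 ^ k = Suc t"
    by (metis add_is_0 not0_implies_Suc power_not_zero zero_neq_numeral)
  have C: "C = 2 * t + 1"
  proof -
    have "2 ^ p * n + 2 ^ (p - 1) = 2 * (2 ^ (k + 1) * n + 2 ^ k)"
      by (simp add: p algebra_simps)
    then show ?thesis
      using assms(2) t by simp
  qed
  have C1: "collatz C 1 = 6 * t + 4"
    by (simp add: C collatz_step_def)
  have C2: "collatz C 2 = 3 * t + 2"
  proof -
    have "collatz C 2 = collatz_step (collatz C 1)"
      by (metis Suc_1 collatz.simps(2))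
    also have "\<dots> = 3 * t + 2"
      unfolding C1 by (simp add: collatz_step_def)
    finally show ?thesis .
  qed
  \<comment> \<open>The extra \<open>2 ^ (p - 1)\<close> from the \<open>+ 1\<close> in the index
    joins \<open>2 ^ (p - 2)\<close> to make \<open>3 * 2 ^ k\<close>.\<close>
  have "2 ^ (p - 1) * (3 * n + 1) + 2 ^ (p - 2) = 3 * (2 ^ (k + 1) * n + 2 ^ k)"
    by (simp add: p algebra_simps)
  then have C2_std: "collatz C 2 = 2 ^ (p - 1) * (3 * n + 1) + 2 ^ (p - 2) - 1"
    unfolding C2 t by simp
  \<comment> \<open>Unfolding \<open>has_standard_form\<close> at exponent \<open>p - 1\<close>
    produces \<open>p - 1 - 1\<close>.\<close>
  have "p - 1 - 1 = p - 2"
    by simp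
  then have "has_standard_form (collatz C 2) (p - 1) (3 * n + 1)"
    using C2_std \<open>p \<ge> 2\<close> by (simp add: has_standard_form_def)
  moreover have "has_standard_form C p n"
    using assms by (simp add: has_standard_form_def)
  moreover have "odd C" "collatz C 1 = 3 * C + 1" "even (collatz C 1)"
    "collatz C 2 = collatz C 1 div 2"
    unfolding C1 C2 by (simp_all add: C)
  ultimately show ?thesis
    using C2_std by blast
qed

end
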